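(* If $\alpha\in\mathcal O_K$ is negative, there are exactly two greedy Laurent series $\alpha_1,\alpha_2\in\mathcal O_\theta^+$ in its Cauchy class; in particular $\pi(\alpha)=\pi(\alpha_1)=\pi(\alpha_2)$.
   Context: $\theta>1$ is a real quadratic unit with $N(\theta)=-1$, so $\theta^2=a\theta+1$ with an integer $a\ge1$; $K=\mathbb Q(\theta)\subset\mathbb R$, $\mathcal O_K$ its ring of integers. A greedy polynomial is a finite sum $\sum_{i=m}^M b_i\theta^i$ with $b_i\in\{0,\dots,a\}$ such that $b_i=a$ implies $b_{i-1}=0$; every nonzero $\alpha\in\mathcal O_K$ is uniquely $\pm$ such a sum with $b_m\ne0$, and $|\alpha|_\theta:=\theta^{-m}$, $|0|_\theta=0$. $\widehat{\mathcal O}_\theta$ is the ring of sequences in $\mathcal O_K$ that are Cauchy for $|\cdot|_\theta$ modulo those with $|f_n|_\theta\to0$; $\mathcal O_K\subset\widehat{\mathcal O}_\theta$ via constant sequences, and the Cauchy class of $\alpha\in\mathcal O_K$ is $\pi(\alpha)$. $\mathcal O_\theta^+$ is the set of greedy Laurent series $x=\sum_{i\ge m}b_i\theta^i$ (formal series with $b_i\in\{0,\dots,a\}$ all of whose truncations are greedy polynomials). A sequence $(x_n)$ in $\mathcal O_K$ is a sequence of partial sums of $x$ if there are integers $M_n$, nondecreasing, $M_n\to\infty$, with $x_n=\sum_{i=m}^{M_n}b_i\theta^i+\delta_n$, $\delta_n$ a greedy polynomial involving only powers $\theta^j$, $j>M_n$. All such sequences are Cauchy and define the same class $\pi(x)\in\widehat{\mathcal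 O}_\theta$ (the Cauchy class of $x$).
   Formalization: The formal theorem assumes O_K = Z[θ]; otherwise (e.g. θ = 2+√5, where (1+√5)/2 is in O_K but not in Z[θ]) some elements of O_K are not ± greedy polynomials, so |·|_θ and the completion are undefined. *)

theory Defs
  imports
    Complex_Main
    "HOL-Algebra.QuotRing"
    "HOL-Algebra.Generated_Rings"
    "HOL-Algebra.Generated_Fields"
    "HOL-Algebra.Algebraic_Closure_Type"
begin

text \<open>
  Throughout, \<open>\<theta> > 1\<close> is a real number with \<open>\<theta>\<^sup>2 = a\<theta> + 1\<close> for a natural number \<open>a \<ge> 1\<close>, i.e. a
  quadratic unit of norm \<open>-1\<close> and trace \<open>a\<close>. (It is automatically irrational, since \<open>a\<^sup>2 + 4\<close> is
  never a square.) These conditions are hypotheses of the theorem, not of the definitions.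
\<close>

abbreviation real_ring :: "real ring" where
  "real_ring \<equiv> ring_of_type_algebra"

definition quadratic_field :: "real \<Rightarrow> real set" where
  "quadratic_field \<theta> = generate_field real_ring {\<theta>}"

definition ring_of_integers :: "real \<Rightarrow> real set" where
  "ring_of_integers \<theta> = {x \<in> quadratic_field \<theta>. algebraic_int x}"

text \<open>
  Greedy polynomials are finite sums of integral powers of the unit \<open>\<theta>\<close>, so they all lie in
  \<open>\<int>[\<theta>]\<close> (as \<open>1/\<theta> = \<theta> - a\<close>). Hence the ring of integers consists of \<open>\<plusminus>\<close> greedy polynomials, and
  the absolute value below is defined on all of it, only if it equals \<open>\<int>[\<theta>]\<close>; this fails e.g. for
  \<open>\<theta> = 2 + \<surd>5\<close>.
\<close>
definition Z_adjoin :: "real \<Rightarrow> real set" where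
  "Z_adjoin \<theta> = generate_ring real_ring {\<theta>}"

text \<open>
  A digit string \<open>b\<close> stands for the formal sum of \<open>b i \<cdot> \<theta>\<^sup>i\<close> over all integers \<open>i\<close>.
\<close>
definition digit_trunc :: "(int \<Rightarrow> nat) \<Rightarrow> int \<Rightarrow> int \<Rightarrow> nat" where
  "digit_trunc b M = (\<lambda>i. if i \<le> M then b i else 0)"

definition greedy_poly :: "nat \<Rightarrow> (int \<Rightarrow> nat) \<Rightarrow> bool" where
  "greedy_poly a b \<longleftrightarrow>
     finite {i. b i \<noteq> 0} \<and> (\<forall>i. b i \<le> a) \<and> (\<forall>i. b i = a \<longrightarrow> b (i - 1) = 0)"

definition digit_value :: "real \<Rightarrow> (int \<Rightarrow> nat) \<Rightarrow> real" where
  "digit_value \<theta> b = (\<Sum>i | b i \<noteq> 0. real (b i) * \<theta> powi i)"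

definition greedy_order :: "real \<Rightarrow> nat \<Rightarrow> real \<Rightarrow> int" where
  "greedy_order \<theta> a \<alpha> =
     (THE m. \<exists>b. greedy_poly a b \<and> b m \<noteq> 0 \<and> (\<forall>i<m. b i = 0) \<and>
                 (\<alpha> = digit_value \<theta> b \<or> \<alpha> = - digit_value \<theta> b))"

definition theta_abs :: "real \<Rightarrow> nat \<Rightarrow> real \<Rightarrow> real" where
  "theta_abs \<theta> a \<alpha> = (if \<alpha> = 0 then 0 else \<theta> powi (- greedy_order \<theta> a \<alpha>))"

definition theta_Cauchy :: "real \<Rightarrow> nat \<Rightarrow> (nat \<Rightarrow> real) \<Rightarrow> bool" where
  "theta_Cauchy \<theta> a f \<longleftrightarrow>
     (\<forall>\<epsilon>>0. \<exists>N. \<forall>m\<ge>N. \<forall>n\<ge>N. theta_abs \<theta> a (f m - f n) < \<epsilon>)"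

definition Cauchy_ring :: "real \<Rightarrow> nat \<Rightarrow> (nat \<Rightarrow> real) ring" where
  "Cauchy_ring \<theta> a =
     \<lparr>carrier = {f. (\<forall>n. f n \<in> ring_of_integers \<theta>) \<and> theta_Cauchy \<theta> a f},
      monoid.mult = (\<lambda>f g n. f n * g n), one = (\<lambda>n. 1),
      ring.zero = (\<lambda>n. 0), add = (\<lambda>f g n. f n + g n)\<rparr>"

definition null_ideal :: "real \<Rightarrow> nat \<Rightarrow> (nat \<Rightarrow> real) set" where
  "null_ideal \<theta> a =
     {f \<in> carrier (Cauchy_ring \<theta> a). (\<lambda>n. theta_abs \<theta> a (f n)) \<longlonglongrightarrow> 0}"

definition theta_completion :: "real \<Rightarrow> nat \<Rightarrow> (nat \<Rightarrow> real) set ring" where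
  "theta_completion \<theta> a = Cauchy_ring \<theta> a Quot null_ideal \<theta> a"

definition Cauchy_class :: "real \<Rightarrow> nat \<Rightarrow> real \<Rightarrow> (nat \<Rightarrow> real) set" where
  "Cauchy_class \<theta> a \<alpha> = null_ideal \<theta> a +>\<^bsub>Cauchy_ring \<theta> a\<^esub> (\<lambda>n. \<alpha>)"

definition greedy_Laurent :: "nat \<Rightarrow> (int \<Rightarrow> nat) set" where
  "greedy_Laurent a =
     {x. (\<exists>m. \<forall>i<m. x i = 0) \<and> (\<forall>M. greedy_poly a (digit_trunc x M))}"

text \<open>
  The digit string \<open>d\<close> below gives the error term \<open>\<delta>\<^sub>n\<close>, which may be zero; its concatenation with the
  truncated series need not be greedy.
\<close>
definition partial_sum_seq :: "real \<Rightarrow> nat \<Rightarrow> (int \<Rightarrow> nat) \<Rightarrow> (nat \<Rightarrow> real) \<Rightarrow> bool" where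
  "partial_sum_seq \<theta> a x s \<longleftrightarrow>
     (\<exists>M :: nat \<Rightarrow> int. mono M \<and> filterlim M at_top sequentially \<and>
       (\<forall>n. \<exists>d. greedy_poly a d \<and> (\<forall>j\<le>M n. d j = 0) \<and>
                s n = digit_value \<theta> (digit_trunc x (M n)) + digit_value \<theta> d))"

definition Cauchy_class_series :: "real \<Rightarrow> nat \<Rightarrow> (int \<Rightarrow> nat) \<Rightarrow> (nat \<Rightarrow> real) set" where
  "Cauchy_class_series \<theta> a x =
     (THE C. C \<in> carrier (theta_completion \<theta> a) \<and> (\<forall>s. partial_sum_seq \<theta> a x s \<longrightarrow> s \<in> C))"

end

theory Submission
  imports Defs
begin

text \<open>
  Let \<open>\<gamma> = - 1 / \<theta>\<close> be the conjugate of \<open>\<theta>\<close>. If the greedy expansion of \<open>x\<close> starts at \<open>m\<close>, then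
  the conjugate of \<open>x\<close> has absolute value between \<open>\<theta> powi (- m - 1)\<close> and \<open>\<theta> powi (1 - m)\<close>. Hence
  conjugation embeds the completion into the reals, and a greedy Laurent series \<open>b\<close> goes to the real
  number \<open>\<Sum>i. b i * \<gamma> powi i\<close>. The one-sided admissible digit strings with first digit \<open>d\<close>
  represent the numbers of an interval, and these intervals meet only in end points. So two series
  with the same value differ from some place on in the strings \<open>d, 0, a, 0, a, \<dots>\<close> and
  \<open>d + 1, a - 1, 0, a, 0, a, \<dots>\<close>. Their periodic tails have opposite parity, which leaves room for at
  most two series. As the tail \<open>0, a, 0, a, \<dots>\<close> at \<open>k\<close> has the class of \<open>- \<theta> powi k\<close>, the two
  series for a negative \<open>\<alpha>\<close> are the greedy polynomials of \<open>\<alpha> + \<theta> powi k\<close> and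
  \<open>\<alpha> + \<theta> powi (k + 1)\<close>, each followed by such a tail.
\<close>

section \<open>Digit values of finitely supported strings and of multisets\<close>

lemma digit_value_superset:
  assumes "finite A" "{i. b i \<noteq> 0} \<subseteq> A"
  shows "digit_value t b = (\<Sum>i\<in>A. real (b i) * t powi i)"
  unfolding digit_value_def using assms by (intro sum.mono_neutral_left) auto

lemma digit_value_count: "digit_value t (count M) = (\<Sum>i\<in>#M. t powi i)"
proof (induction M)
  case (add x M)
  have "digit_value t (count (add_mset x M))
      = (\<Sum>i\<in>set_mset (add_mset x M). real (count (add_mset x M) i) * t powi i)"
    by (rule digit_value_superset) (auto split: if_splits)
  also have "\<dots> = (\<Sum>i\<in>set_mset (add_mset x M). real (count M i) * t powi i
                        + (if i = x then t powi i else 0))"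
    by (intro sum.cong) (auto simp: algebra_simps)
  also have "\<dots> = digit_value t (count M) + t powi x"
    by (subst digit_value_superset[of "set_mset (add_mset x M)"])
      (auto simp: sum.distrib sum.delta)
  finally show ?case by (simp only: add.IH image_mset_add_mset sum_mset.add_mset add.commute)
qed (simp add: digit_value_def)

lemma finite_support_bounds:
  fixes b :: "int \<Rightarrow> nat"
  assumes "finite {i. b i \<noteq> 0}"
  obtains m K where "\<And>i. i < m \<Longrightarrow> b i = 0" "\<And>i. i > K \<Longrightarrow> b i = 0"
proof -
  have "bdd_below {i. b i \<noteq> 0}" "bdd_above {i. b i \<noteq> 0}" using assms by simp_all
  then obtain m K where "\<And>i. b i \<noteq> 0 \<Longrightarrow> m \<le> i" "\<And>i. b i \<noteq> 0 \<Longrightarrow> i \<le> K"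
    by (auto simp: bdd_below_def bdd_above_def)
  thus ?thesis using that[of m K] by (meson not_le)
qed

locale unit_base =
  fixes \<theta> :: real and a :: nat
  assumes theta_gt_1: "\<theta> > 1" and a_ge_1: "a \<ge> 1" and theta_sq: "\<theta>\<^sup>2 = real a * \<theta> + 1"
begin

definition \<gamma> :: real where "\<gamma> = - 1 / \<theta>"

lemma theta_pos: "\<theta> > 0" using theta_gt_1 by simp

lemma gamma_eq: "\<gamma> = real a - \<theta>"
  using theta_sq theta_pos by (simp add: \<gamma>_def field_simps power2_eq_square)

lemma gamma_theta: "\<gamma> * \<theta> = - 1"
  using theta_pos by (simp add: \<gamma>_def)

lemma gamma_neg: "\<gamma> < 0" and gamma_nz: "\<gamma> \<noteq> 0" and theta_nz: "\<theta> \<noteq> 0"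
  using theta_pos by (auto simp: \<gamma>_def)

lemma gamma_sq: "\<gamma>\<^sup>2 = real a * \<gamma> + 1"
proof -
  have "\<gamma>\<^sup>2 = \<gamma> * (real a - \<theta>)" by (simp add: power2_eq_square flip: gamma_eq)
  thus ?thesis using gamma_theta by (simp add: algebra_simps)
qed

lemma abs_gamma: "\<bar>\<gamma>\<bar> = 1 / \<theta>" and abs_gamma_less_1: "\<bar>\<gamma>\<bar> < 1"
  using theta_gt_1 by (auto simp: \<gamma>_def)

lemma abs_gamma_powi: "\<bar>\<gamma> powi k\<bar> = \<theta> powi (- k)"
  by (simp add: power_int_abs abs_gamma power_int_minus power_int_inverse divide_inverse)

lemma powi_mono: "i \<le> j \<Longrightarrow> \<theta> powi i \<le> \<theta> powi j"
  using theta_gt_1 by (simp add: power_int_increasing)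

text \<open>A multiset of exponents is a representation with unrestricted digits:
  \<open>count\<close> reads off the digit string, and \<open>size\<close> is the digit sum, which
  the carries below never increase.\<close>

definition expand :: "int multiset \<Rightarrow> real" where
  "expand M = (\<Sum>i\<in>#M. \<theta> powi i)"

lemma expand_union [simp]: "expand (M + N) = expand M + expand N"
  by (simp add: expand_def)

lemma expand_simps [simp]: "expand {#} = 0" "expand (add_mset i M) = \<theta> powi i + expand M"
  "expand (replicate_mset n i) = real n * \<theta> powi i"
  by (simp_all add: expand_def)

lemma expand_ge_0: "expand M \<ge> 0"
  using theta_pos by (induction M) (simp_all add: add_nonneg_nonneg)

lemma expand_ge: "i \<in># M \<Longrightarrow> \<theta> powi i \<le> expand M"
  using expand_ge_0 by (force dest!: multi_member_split)

subsection \<open>Finiteness of greedy expansions\<close>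

lemma powi_carry: "\<theta> powi (i + 1) = real a * \<theta> powi i + \<theta> powi (i - 1)"
proof -
  have "\<theta> powi (i + 1) = \<theta> powi (i - 1) * \<theta>\<^sup>2"
    using theta_nz by (simp add: power_int_add power_int_diff power2_eq_square)
  also have "\<dots> = real a * (\<theta> powi (i - 1) * \<theta>) + \<theta> powi (i - 1)"
    by (simp add: theta_sq algebra_simps)
  also have "\<theta> powi (i - 1) * \<theta> = \<theta> powi i"
    using theta_nz by (simp add: power_int_diff)
  finally show ?thesis .
qed

lemma count_le_imp_split: "n \<le> count M i \<Longrightarrow> \<exists>R. M = replicate_mset n i + R"
  by (metis count_le_replicate_mset_subset_eq subset_mset.add_diff_inverse)

lemma unbounded_powi: "\<exists>K::int. x < \<theta> powi K"
proof -
  obtain n where "x < \<theta> ^ n" using real_arch_pow[OF theta_gt_1] by blast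
  thus ?thesis by (intro exI[of _ "int n"]) simp
qed

text \<open>Among all representations with at most \<open>size M\<close> summands, take one whose top exponent is
  maximal: any violation of the digit conditions after normalising the rest could be carried into
  a higher power of the base.\<close>
lemma greedy_normal_form:
  "\<exists>N. size N \<le> size M \<and> expand N = expand M \<and> greedy_poly a (count N)"
proof (induction "size M" arbitrary: M rule: less_induct)
  case less
  show ?case
  proof (cases "M = {#}")
    case True
    thus ?thesis using a_ge_1 by (intro exI[of _ "{#}"]) (auto simp: greedy_poly_def)
  next
    case False
    define I where "I = {i. \<exists>N. i \<in># N \<and> size N \<le> size M \<and> expand N = expand M}"
    obtain i0 where i0: "i0 \<in> I" using False by (force simp: I_def)
    \<comment> \<open>A power of \<theta> occurring in a representation is bounded by the value, so
      \<open>I\<close> is bounded above.\<close>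
    obtain K where K: "expand M < \<theta> powi K" using unbounded_powi by blast
    have bd: "i < K" if "i \<in> I" for i
    proof (rule ccontr)
      assume "\<not> i < K"
      hence "\<theta> powi K \<le> \<theta> powi i" by (intro powi_mono) simp
      also have "\<dots> \<le> expand M" using that expand_ge by (force simp: I_def)
      finally show False using K by simp
    qed
    \<comment> \<open>Cutting off below the member \<open>i0\<close> leaves a finite set with the
      same maximum.\<close>
    define J where "J = {i \<in> I. i0 \<le> i}"
    have fJ: "finite J" by (rule finite_subset[of _ "{i0..K}"]) (use bd in \<open>auto simp: J_def less_imp_le\<close>)
    define i where "i = Max J"
    have "J \<noteq> {}" using i0 by (auto simp: J_def)
    hence iJ: "i \<in> J" using fJ by (simp add: i_def)
    have top: "j \<le> i" if "j \<in> I" for j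
    proof (cases "i0 \<le> j")
      case True thus ?thesis using that fJ by (simp add: i_def J_def)
    next
      case False thus ?thesis using iJ by (simp add: J_def)
    qed
    have top': "j \<le> i" if "j \<in># N" "size N \<le> size M" "expand N = expand M" for j N
      using that top by (auto simp: I_def)
    obtain N where N: "i \<in># N" "size N \<le> size M" "expand N = expand M"
      using iJ by (auto simp: J_def I_def)
    obtain N' where N': "N = add_mset i N'" using N(1) by (meson multi_member_split)
    have "size N' < size M" using N N' by simp
    from less[OF this] obtain B where B: "size B \<le> size N'" "expand B = expand N'"
      "greedy_poly a (count B)" by blast
    define C where "C = add_mset i B"
    have C: "size C \<le> size M" "expand C = expand M"
      using B N N' by (auto simp: C_def)
    have B_le: "count B j \<le> a" and B_adm: "count B j = a \<Longrightarrow> count B (j - 1) = 0" for j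
      using B(3) by (auto simp: greedy_poly_def)
    \<comment> \<open>A digit \<open>a + 1\<close> at \<open>i\<close> could be replaced by 1, 0,
      \<open>a - 1\<close>, 1 at \<open>i + 1\<close>, \<open>i\<close>, \<open>i - 1\<close>,
      \<open>i - 2\<close>: two uses of \<open>powi_carry\<close> that keep the size but exceed the
      maximal exponent.\<close>
    have ne1: "count B i \<noteq> a"
    proof
      assume ba: "count B i = a"
      then obtain R where R: "B = replicate_mset a i + R" using count_le_imp_split[of a B i] by auto
      define D where "D = add_mset (i + 1) (add_mset (i - 2) (replicate_mset (a - 1) (i - 1) + R))"
      have sz: "size D \<le> size M" using C(1) a_ge_1 by (simp add: D_def C_def R)
      have e: "expand D = expand M"
        unfolding C(2)[symmetric] using a_ge_1 powi_carry[of i] powi_carry[of "i - 1"]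
        by (simp add: D_def C_def R of_nat_diff algebra_simps)
      have "i + 1 \<le> i" using sz e by (intro top'[of _ D]) (auto simp: D_def)
      thus False by simp
    qed
    \<comment> \<open>Here \<open>C\<close> has digit \<open>a\<close> at \<open>i\<close>, so a
      nonzero digit just below would permit a direct carry to \<open>i + 1\<close>.\<close>
    have ne2: "count B (i - 1) = 0" if ba: "Suc (count B i) = a"
    proof (rule ccontr)
      assume "count B (i - 1) \<noteq> 0"
      then obtain B' where B': "B = add_mset (i - 1) B'"
        by (metis count_inI multi_member_split)
      have "a - 1 \<le> count B' i" using ba B' by simp
      then obtain R where R: "B' = replicate_mset (a - 1) i + R" using count_le_imp_split[of "a - 1" B' i] by auto
      define D where "D = add_mset (i + 1) R"
      have sz: "size D \<le> size M" using C(1) a_ge_1 by (simp add: D_def C_def R B')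
      have e: "expand D = expand M"
        unfolding C(2)[symmetric] using a_ge_1 powi_carry[of i]
        by (simp add: D_def C_def R B' of_nat_diff algebra_simps)
      have "i + 1 \<le> i" using sz e by (intro top'[of _ D]) (auto simp: D_def)
      thus False by simp
    qed
    have "greedy_poly a (count C)"
      unfolding greedy_poly_def
    proof (intro conjI allI impI)
      show "finite {j. count C j \<noteq> 0}" by simp
      show "count C j \<le> a" for j
        using B_le[of j] ne1 by (auto simp: C_def)
      fix j assume j: "count C j = a"
      show "count C (j - 1) = 0"
      proof (cases "j = i")
        case True thus ?thesis using j ne2 by (simp add: C_def)
      next
        case False
        have "j \<in># C" using j a_ge_1 by (metis count_greater_zero_iff less_le_trans zero_less_one)
        \<comment> \<open>Maximality excludes exponents above \<open>i\<close>, so the extra summand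
          at \<open>i\<close> cannot spoil the condition at \<open>i + 1\<close>.\<close>
        hence "j < i" using top'[of j C] C False by force
        thus ?thesis using j B_adm[of j] False by (simp add: C_def)
      qed
    qed
    thus ?thesis using C by blast
  qed
qed

subsection \<open>Expansions in base \<open>\<gamma>\<close>\<close>

text \<open>The digits from \<open>m\<close> on, with \<open>m\<close> moved to the unit place. This
  scaling makes the bounds below independent of the position.\<close>

definition V :: "(int \<Rightarrow> nat) \<Rightarrow> int \<Rightarrow> real" where
  "V x m = (\<Sum>n. real (x (m + int n)) * \<gamma> ^ n)"

definition digits_le :: "(int \<Rightarrow> nat) \<Rightarrow> bool" where
  "digits_le x \<longleftrightarrow> (\<forall>i. x i \<le> a)"

definition admissible :: "(int \<Rightarrow> nat) \<Rightarrow> bool" where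
  "admissible x \<longleftrightarrow> digits_le x \<and> (\<forall>i. x i = a \<longrightarrow> x (i - 1) = 0)"

lemma V_summable:
  assumes "digits_le x" shows "summable (\<lambda>n. real (x (m + int n)) * \<gamma> ^ n)"
proof (rule summable_comparison_test')
  show "summable (\<lambda>n. real a * \<bar>\<gamma>\<bar> ^ n)"
    using abs_gamma_less_1 by (intro summable_mult summable_geometric) simp
  show "norm (real (x (m + int n)) * \<gamma> ^ n) \<le> real a * \<bar>\<gamma>\<bar> ^ n" if "n \<ge> 0" for n
    using assms by (auto simp: abs_mult power_abs digits_le_def intro!: mult_right_mono)
qed

lemma V_step: "digits_le x \<Longrightarrow> V x m = real (x m) + \<gamma> * V x (m + 1)"
proof -
  assume *: "digits_le x"
  have "(\<Sum>n. real (x (m + int (Suc n))) * \<gamma> ^ Suc n) = V x m - real (x m)"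
    using suminf_split_head[OF V_summable[OF *, of m]] by (simp add: V_def)
  moreover have "(\<Sum>n. real (x (m + int (Suc n))) * \<gamma> ^ Suc n) = \<gamma> * V x (m + 1)"
    unfolding V_def using V_summable[OF *, of "m + 1"]
    by (subst suminf_mult [symmetric]) (auto simp: algebra_simps)
  ultimately show ?thesis by simp
qed

definition alt :: "int \<Rightarrow> int \<Rightarrow> nat" where
  "alt k i = (if even (i - k) then 0 else a)"

lemma digits_le_alt: "digits_le (alt k)" by (simp add: digits_le_def alt_def)

text \<open>Period two turns \<open>V_step\<close> into a linear equation; by the quadratic equation
  of \<gamma> its only solution is -1.\<close>

lemma V_alt: "V (alt k) k = - 1"
proof -
  have eq: "V (alt k) (k + 1 + 1) = V (alt k) k"
    unfolding V_def alt_def by (intro suminf_cong) (simp add: algebra_simps)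
  have "V (alt k) k = \<gamma> * V (alt k) (k + 1)" "V (alt k) (k + 1) = real a + \<gamma> * V (alt k) k"
    using V_step[OF digits_le_alt, of k k] V_step[OF digits_le_alt, of k "k + 1"]
    unfolding eq by (simp_all add: alt_def)
  hence "V (alt k) k = \<gamma> * real a + \<gamma>\<^sup>2 * V (alt k) k"
    by (metis distrib_left mult.assoc power2_eq_square)
  hence "real a * \<gamma> * (V (alt k) k + 1) = 0"
    by (simp add: gamma_sq algebra_simps)
  thus ?thesis using gamma_nz a_ge_1 by simp
qed

text \<open>Even powers of \<gamma> are positive and odd ones negative, so the digits 0, a, 0, a,
  ... minimise every term at once. In the case of equality a vanishing sum of nonnegative terms
  fixes each digit.\<close>

lemma V_ge: assumes "digits_le x" shows "V x m \<ge> - 1"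
  and "V x m = - 1 \<Longrightarrow> i \<ge> m \<Longrightarrow> x i = alt m i"
proof -
  let ?d = "\<lambda>n. real (x (m + int n)) * \<gamma> ^ n - real (alt m (m + int n)) * \<gamma> ^ n"
  have sm: "summable ?d"
    by (intro summable_diff V_summable assms digits_le_alt)
  have sd: "suminf ?d = V x m + 1"
    using suminf_diff[OF V_summable[OF assms, of m] V_summable[OF digits_le_alt, of m m]] V_alt[of m]
    by (simp add: V_def)
  have nn: "?d n \<ge> 0" for n
  proof (cases "even n")
    case True
    thus ?thesis by (simp add: alt_def zero_le_even_power)
  next
    case False
    hence "\<gamma> ^ n < 0" using gamma_neg by (simp add: power_less_zero_eq)
    moreover have "real (x (m + int n)) \<le> real a" using assms by (simp add: digits_le_def)
    ultimately show ?thesis using False by (simp add: alt_def mult_right_mono_neg)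
  qed
  show "V x m \<ge> - 1" using suminf_nonneg[OF sm nn] sd by simp
  assume "V x m = - 1" and "i \<ge> m"
  hence "suminf ?d = 0" using sd by simp
  hence "?d (nat (i - m)) = 0" using suminf_eq_zero_iff[OF sm nn] by blast
  thus "x i = alt m i" using \<open>i \<ge> m\<close> gamma_nz by simp
qed

text \<open>The lower bound -1 one place further on, multiplied by the negative number \<gamma>,
  becomes the upper bound.\<close>

lemma V_le: assumes "digits_le x" shows "V x m \<le> real (x m) + 1 / \<theta>"
  and "V x m = real (x m) + 1 / \<theta> \<Longrightarrow> V x (m + 1) = - 1"
proof -
  have "V x m = real (x m) + 1 / \<theta> + \<gamma> * (V x (m + 1) + 1)"
    using V_step[OF assms, of m] by (simp add: \<gamma>_def distrib_left)
  moreover have "\<gamma> * (V x (m + 1) + 1) \<le> 0"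
    using V_ge(1)[OF assms, of "m + 1"] gamma_neg by (simp add: mult_nonpos_nonneg)
  ultimately show "V x m \<le> real (x m) + 1 / \<theta>"
    and "V x m = real (x m) + 1 / \<theta> \<Longrightarrow> V x (m + 1) = - 1"
    using gamma_nz by auto
qed

lemma inverse_theta: "1 / \<theta> = \<theta> - real a"
  using gamma_eq by (simp add: \<gamma>_def)

lemma V_le_theta: "digits_le x \<Longrightarrow> V x m \<le> \<theta>"
proof -
  assume "digits_le x"
  moreover from this have "real (x m) \<le> real a" by (simp add: digits_le_def)
  ultimately show ?thesis using V_le(1)[of x m] inverse_theta by linarith
qed

lemma admissible_next: "admissible x \<Longrightarrow> x m \<noteq> 0 \<Longrightarrow> x (m + 1) + 1 \<le> a"
  by (metis Suc_eq_plus1 add_diff_cancel_right' admissible_def digits_le_def le_neq_implies_less Suc_leI)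

text \<open>A nonzero digit at \<open>m\<close> keeps the next one at most \<open>a - 1\<close>, so
  the tail from \<open>m + 1\<close> has value at most \<open>\<theta> - 1\<close>, and the factor
  \<gamma> < 0 turns this into a lower bound. Equality makes the tail from \<open>m + 2\<close>
  minimal, hence alternating.\<close>

lemma V_ge_nonzero:
  assumes "admissible x" "x m \<noteq> 0"
  shows "V x m \<ge> real (x m) - 1 + 1 / \<theta>"
    and "V x m = real (x m) - 1 + 1 / \<theta> \<Longrightarrow> V x (m + 2) = - 1"
proof -
  have d: "digits_le x" using assms by (simp add: admissible_def)
  have x1: "real (x (m + 1)) \<le> real a - 1" using admissible_next[OF assms] by linarith
  have le: "V x (m + 1) \<le> \<theta> - 1" using V_le(1)[OF d, of "m + 1"] x1 inverse_theta by linarith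
  have eq: "V x m = real (x m) - 1 + 1 / \<theta> + \<gamma> * (V x (m + 1) - (\<theta> - 1))"
    using V_step[OF d, of m] gamma_theta by (simp add: \<gamma>_def algebra_simps)
  have "\<gamma> * (V x (m + 1) - (\<theta> - 1)) \<ge> 0"
    using le gamma_neg by (simp add: mult_nonpos_nonpos)
  thus "V x m \<ge> real (x m) - 1 + 1 / \<theta>" using eq by simp
  assume "V x m = real (x m) - 1 + 1 / \<theta>"
  hence "V x (m + 1) = \<theta> - 1" using eq gamma_nz by simp
  hence "V x (m + 1) = real (x (m + 1)) + 1 / \<theta>"
    using V_le(1)[OF d, of "m + 1"] x1 inverse_theta by linarith
  from V_le(2)[OF d this] show "V x (m + 2) = - 1" by (simp add: add.commute)
qed

lemma V_diff_agree:
  assumes "digits_le x" "digits_le y" "m \<le> k" "\<And>i. m \<le> i \<Longrightarrow> i < k \<Longrightarrow> x i = y i"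
  shows "\<gamma> powi m * (V x m - V y m) = \<gamma> powi k * (V x k - V y k)"
  using assms(3,4)
proof (induction k rule: int_ge_induct)
  case (step k)
  have "V x k - V y k = \<gamma> * (V x (k + 1) - V y (k + 1))"
    using V_step[OF assms(1), of k] V_step[OF assms(2), of k] step by (simp add: algebra_simps)
  thus ?case using step gamma_nz by (simp add: power_int_add mult.assoc)
qed simp

section \<open>Alternating tails and coincidences of values\<close>

definition tail_alt :: "(int \<Rightarrow> nat) \<Rightarrow> int \<Rightarrow> bool" where
  "tail_alt x k \<longleftrightarrow> (\<exists>j. \<forall>i\<ge>j. x i = alt k i)"

lemma tail_alt_shift: "tail_alt x (k + 2) \<longleftrightarrow> tail_alt x k"
  by (simp add: tail_alt_def alt_def)

lemma tail_alt_not_Suc: "tail_alt x k \<Longrightarrow> \<not> tail_alt x (k + 1)"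
proof
  assume "tail_alt x k" "tail_alt x (k + 1)"
  then obtain i j where "\<And>l. l \<ge> i \<Longrightarrow> x l = alt k l" "\<And>l. l \<ge> j \<Longrightarrow> x l = alt (k + 1) l"
    by (auto simp: tail_alt_def)
  from this(1)[of "max i j"] this(2)[of "max i j"] show False
    using a_ge_1 by (auto simp: alt_def split: if_splits)
qed

text \<open>As the tail may begin anywhere, only the parity of the reference place matters. A string
  with such a tail thus has one well-defined parity, which is the invariant used for counting
  series.\<close>

lemma tail_alt_parity: "tail_alt x k \<Longrightarrow> tail_alt x l \<longleftrightarrow> even (k - l)"
proof -
  assume k: "tail_alt x k"
  show ?thesis
  proof (cases "even (k - l)")
    case True
    hence "alt k = alt l" by (auto simp: alt_def fun_eq_iff)
    thus ?thesis using k True by (simp add: tail_alt_def)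
  next
    case False
    hence "alt (k + 1) = alt l" by (auto simp: alt_def fun_eq_iff)
    hence "tail_alt x (k + 1) = tail_alt x l" by (simp add: tail_alt_def)
    thus ?thesis using tail_alt_not_Suc[OF k] False by simp
  qed
qed

text \<open>Values with leading digit \<open>x k\<close> reach at most
  \<open>real (x k) + 1 / \<theta>\<close>, and those with a larger leading digit are at least that.
  Equal values therefore attain both bounds, which forces the extremal tails.\<close>

lemma V_eq_lt:
  assumes "admissible x" "admissible y" "x k < y k" "V x k = V y k"
  shows "tail_alt x (k + 1)" "tail_alt y (k + 2)"
proof -
  have dx: "digits_le x" and dy: "digits_le y" using assms by (auto simp: admissible_def)
  have y: "y k \<noteq> 0" using assms by simp
  have lt: "real (x k) + 1 \<le> real (y k)" using assms by linarith
  have "V x (k + 1) = - 1"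
    using V_le[OF dx, of k] V_ge_nonzero(1)[OF assms(2) y] lt assms(4) by linarith
  thus "tail_alt x (k + 1)"
    unfolding tail_alt_def using V_ge(2)[OF dx] by blast
  have "V y (k + 2) = - 1"
    using V_le(1)[OF dx, of k] V_ge_nonzero[OF assms(2) y] lt assms(4) by linarith
  thus "tail_alt y (k + 2)"
    unfolding tail_alt_def using V_ge(2)[OF dy] by blast
qed

text \<open>The first place of disagreement reduces this to \<open>V_eq_lt\<close>, whose two tails
  are one place apart.\<close>

lemma V_eq_imp_tail_alt:
  assumes "admissible x" "admissible y" "\<And>i. i < m \<Longrightarrow> x i = y i" "V x m = V y m" "x \<noteq> y"
  shows "\<exists>k. tail_alt x k \<and> tail_alt y (k + 1)"
proof -
  obtain j where j: "x j \<noteq> y j" using assms by blast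
  have jm: "j \<ge> m" using assms(3)[of j] j by linarith
  define n where "n = (LEAST n. x (m + int n) \<noteq> y (m + int n))"
  have "x (m + int (nat (j - m))) \<noteq> y (m + int (nat (j - m)))" using j jm by simp
  hence n: "x (m + int n) \<noteq> y (m + int n)" unfolding n_def by (rule LeastI)
  define k where "k = m + int n"
  have agree: "x i = y i" if "m \<le> i" "i < k" for i
    using not_less_Least[of "nat (i - m)" "\<lambda>n. x (m + int n) \<noteq> y (m + int n)"] that
    by (auto simp: k_def n_def [symmetric])
  have "V x k = V y k"
    using V_diff_agree[of x y m k] agree assms gamma_nz by (simp add: admissible_def k_def)
  moreover have "x k < y k \<or> y k < x k" using n by (auto simp: k_def)
  ultimately show ?thesis
  proof (elim disjE)
    assume "x k < y k" "V x k = V y k"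
    thus ?thesis using V_eq_lt[OF assms(1,2)] by (metis add.assoc one_add_one)
  next
    assume "y k < x k" "V x k = V y k"
    hence "tail_alt y (k + 1)" "tail_alt x (k + 2)" using V_eq_lt[OF assms(2,1)] by auto
    \<comment> \<open>With the roles exchanged, the tail of \<open>x\<close> sits at
      \<open>k + 2\<close>, which is the same as one at \<open>k\<close>.\<close>
    thus ?thesis using tail_alt_shift by (intro exI[of _ k]) auto
  qed
qed

section \<open>Values of finite and Laurent digit strings in base \<gamma>\<close>

definition lval :: "(int \<Rightarrow> nat) \<Rightarrow> real" where
  "lval x = lim (\<lambda>n. digit_value \<gamma> (digit_trunc x (int n)))"

lemma digit_value_trunc:
  assumes "\<And>i. i < m \<Longrightarrow> x i = 0"
  shows "digit_value t (digit_trunc x (m + int N - 1)) = (\<Sum>n<N. real (x (m + int n)) * t powi (m + int n))"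
proof -
  have "digit_value t (digit_trunc x (m + int N - 1))
      = (\<Sum>i\<in>{m..<m + int N}. real (digit_trunc x (m + int N - 1) i) * t powi i)"
  proof (rule digit_value_superset)
    show "{i. digit_trunc x (m + int N - 1) i \<noteq> 0} \<subseteq> {m..<m + int N}"
      using assms by (auto simp: digit_trunc_def simp flip: not_less split: if_splits)
  qed simp
  also have "\<dots> = (\<Sum>n<N. real (x (m + int n)) * t powi (m + int n))"
    by (rule sum.reindex_bij_witness[of _ "\<lambda>n. m + int n" "\<lambda>i. nat (i - m)"])
      (auto simp: digit_trunc_def)
  finally show ?thesis .
qed

text \<open>General cut-offs \<open>M\<close> are allowed because a sequence of partial sums may be
  cut at any places tending to infinity.\<close>

lemma trunc_tendsto:
  assumes "digits_le x" "\<And>i. i < m \<Longrightarrow> x i = 0" "filterlim M at_top sequentially"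
  shows "(\<lambda>n. digit_value \<gamma> (digit_trunc x (M n))) \<longlonglongrightarrow> \<gamma> powi m * V x m"
proof -
  have "(\<lambda>N. \<gamma> powi m * (\<Sum>n<N. real (x (m + int n)) * \<gamma> ^ n)) \<longlonglongrightarrow> \<gamma> powi m * V x m"
    unfolding V_def by (intro tendsto_mult_left summable_LIMSEQ V_summable assms)
  moreover have "filterlim (\<lambda>n. nat (M n - m + 1)) at_top sequentially"
    unfolding filterlim_at_top
  proof
    fix Z
    have "\<forall>\<^sub>F n in sequentially. int Z + m \<le> M n"
      using assms(3) by (simp add: filterlim_at_top)
    thus "\<forall>\<^sub>F n in sequentially. Z \<le> nat (M n - m + 1)" by eventually_elim linarith
  qed
  ultimately have "(\<lambda>n. \<gamma> powi m * (\<Sum>l<nat (M n - m + 1). real (x (m + int l)) * \<gamma> ^ l)) \<longlonglongrightarrow> \<gamma> powi m * V x m"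
    by (rule filterlim_compose)
  moreover have "\<forall>\<^sub>F n in sequentially. m \<le> M n"
    using assms(3) by (simp add: filterlim_at_top)
  hence "\<forall>\<^sub>F n in sequentially. \<gamma> powi m * (\<Sum>l<nat (M n - m + 1). real (x (m + int l)) * \<gamma> ^ l)
      = digit_value \<gamma> (digit_trunc x (M n))"
  proof eventually_elim
    case (elim n)
    thus ?case
      using digit_value_trunc[of m x \<gamma> "nat (M n - m + 1)"] assms(2) gamma_nz
      by (simp add: power_int_add sum_distrib_left mult_ac)
  qed
  ultimately show ?thesis by (rule Lim_transform_eventually)
qed

lemma lval_eq:
  assumes "digits_le x" "\<And>i. i < m \<Longrightarrow> x i = 0"
  shows "lval x = \<gamma> powi m * V x m"
  unfolding lval_def by (intro limI trunc_tendsto assms filterlim_int_sequentially)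

lemma lval_finite:
  assumes "finite {i. b i \<noteq> 0}"
  shows "lval b = digit_value \<gamma> b"
proof -
  obtain K where K: "\<And>i. i > K \<Longrightarrow> b i = 0" using finite_support_bounds[OF assms] by metis
  have "\<forall>\<^sub>F n in sequentially. digit_value \<gamma> b = digit_value \<gamma> (digit_trunc b (int n))"
    using eventually_ge_at_top[of "nat K"]
  proof eventually_elim
    case (elim n)
    hence "digit_trunc b (int n) = b" using K by (force simp: digit_trunc_def)
    thus ?case by simp
  qed
  hence "(\<lambda>n. digit_value \<gamma> (digit_trunc b (int n))) \<longlonglongrightarrow> digit_value \<gamma> b"
    by (rule Lim_transform_eventually[OF tendsto_const])
  thus ?thesis unfolding lval_def by (rule limI)
qed

lemma greedy_polyD: "greedy_poly a b \<Longrightarrow> admissible b" "greedy_poly a b \<Longrightarrow> digits_le b"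
  "greedy_poly a b \<Longrightarrow> finite {i. b i \<noteq> 0}"
  by (simp_all add: greedy_poly_def admissible_def digits_le_def)

text \<open>Cutting at \<open>M\<close> creates no violation: the condition at a place looks
  downwards only, and a removed digit becomes 0, which differs from \<open>a\<close>.\<close>

lemma greedy_Laurent_iff:
  "x \<in> greedy_Laurent a \<longleftrightarrow> admissible x \<and> (\<exists>m. \<forall>i<m. x i = 0)"
proof
  assume x: "x \<in> greedy_Laurent a"
  hence "x i \<le> a" "x i = a \<Longrightarrow> x (i - 1) = 0" for i
    by (auto simp: greedy_Laurent_def greedy_poly_def digit_trunc_def dest!: spec[of _ i])
  thus "admissible x \<and> (\<exists>m. \<forall>i<m. x i = 0)"
    using x by (auto simp: greedy_Laurent_def admissible_def digits_le_def)
next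
  assume *: "admissible x \<and> (\<exists>m. \<forall>i<m. x i = 0)"
  then obtain m where m: "\<And>i. i < m \<Longrightarrow> x i = 0" by blast
  have "finite {i. digit_trunc x M i \<noteq> 0}" for M
    by (rule finite_subset[of _ "{m..M}"])
      (use m in \<open>auto simp: digit_trunc_def simp flip: not_less split: if_splits\<close>)
  thus "x \<in> greedy_Laurent a"
    using * a_ge_1
    by (auto simp: greedy_Laurent_def greedy_poly_def digit_trunc_def admissible_def digits_le_def)
qed

lemma lval_eq_imp_tail_alt:
  assumes "admissible x" "admissible y" "\<And>i. i < m \<Longrightarrow> x i = 0" "\<And>i. i < l \<Longrightarrow> y i = 0"
    "lval x = lval y" "x \<noteq> y"
  shows "\<exists>k. tail_alt x k \<and> tail_alt y (k + 1)"
proof (rule V_eq_imp_tail_alt[where m = "min m l"])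
  have "digits_le x" "digits_le y" using assms by (auto simp: admissible_def)
  thus "V x (min m l) = V y (min m l)"
    using lval_eq[of x "min m l"] lval_eq[of y "min m l"] assms gamma_nz by simp
qed (use assms in auto)

lemma finite_not_tail_alt: "finite {i. b i \<noteq> 0} \<Longrightarrow> \<not> tail_alt b k"
proof
  assume f: "finite {i. b i \<noteq> 0}" and "tail_alt b k"
  then obtain j where j: "\<And>i. i \<ge> j \<Longrightarrow> b i = alt k i" by (auto simp: tail_alt_def)
  obtain K where K: "\<And>i. i > K \<Longrightarrow> b i = 0" using finite_support_bounds[OF f] by metis
  \<comment> \<open>A place beyond \<open>j\<close> and \<open>K\<close> at odd distance from
    \<open>k\<close>, where the alternating tail has the digit \<open>a\<close>.\<close>
  define i where "i = k + 2 * (\<bar>j\<bar> + \<bar>K\<bar> + \<bar>k\<bar>) + 1"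
  have "b i = a" using j[of i] by (simp add: i_def alt_def)
  moreover have "i > K" by (simp add: i_def)
  ultimately show False using K[of i] a_ge_1 by simp
qed

text \<open>Distinct strings of equal value would have infinite alternating tails, which finite
  support excludes.\<close>

lemma greedy_poly_unique:
  assumes "greedy_poly a b" "greedy_poly a c" "digit_value \<gamma> b = digit_value \<gamma> c"
  shows "b = c"
proof (rule ccontr)
  assume ne: "b \<noteq> c"
  obtain m where "\<And>i. i < m \<Longrightarrow> b i = 0" using finite_support_bounds[OF greedy_polyD(3)[OF assms(1)]] by metis
  moreover obtain l where "\<And>i. i < l \<Longrightarrow> c i = 0" using finite_support_bounds[OF greedy_polyD(3)[OF assms(2)]] by metis
  ultimately obtain k where "tail_alt b k"
    using lval_eq_imp_tail_alt[of b c] ne assms greedy_polyD lval_finite by metis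
  thus False using finite_not_tail_alt greedy_polyD(3)[OF assms(1)] by blast
qed

lemma abs_digit_value_le:
  assumes "greedy_poly a b" "\<And>i. i < m \<Longrightarrow> b i = 0"
  shows "\<bar>digit_value \<gamma> b\<bar> \<le> \<theta> * \<theta> powi (- m)"
proof -
  have d: "digits_le b" by (rule greedy_polyD[OF assms(1)])
  have "\<bar>V b m\<bar> \<le> \<theta>" using V_ge(1)[OF d, of m] V_le_theta[OF d, of m] theta_gt_1 by linarith
  hence "\<bar>\<gamma> powi m * V b m\<bar> \<le> \<theta> powi (- m) * \<theta>"
    unfolding abs_mult abs_gamma_powi using theta_pos by (intro mult_left_mono) auto
  thus ?thesis
    using lval_eq[OF d assms(2)] lval_finite[OF greedy_polyD(3)[OF assms(1)]] by (simp add: mult.commute)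
qed

text \<open>The lowest digit is at least 1, so \<open>V b m\<close> is at least
  \<open>1 / \<theta>\<close>; the rest is the scaling by \<open>\<gamma> powi m\<close>.\<close>

lemma abs_digit_value_ge:
  assumes "greedy_poly a b" "\<And>i. i < m \<Longrightarrow> b i = 0" "b m \<noteq> 0"
  shows "\<bar>digit_value \<gamma> b\<bar> \<ge> \<theta> powi (- m) / \<theta>"
proof -
  have d: "digits_le b" by (rule greedy_polyD[OF assms(1)])
  have "\<bar>V b m\<bar> \<ge> 1 / \<theta>" using V_ge_nonzero(1)[OF greedy_polyD(1)[OF assms(1)] assms(3)] assms(3) by linarith
  hence "\<bar>\<gamma> powi m * V b m\<bar> \<ge> \<theta> powi (- m) * (1 / \<theta>)"
    unfolding abs_mult abs_gamma_powi using theta_pos by (intro mult_left_mono) auto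
  thus ?thesis
    using lval_eq[OF d assms(2)] lval_finite[OF greedy_polyD(3)[OF assms(1)]] by simp
qed

subsection \<open>Conjugation\<close>

text \<open>Conjugation as a relation on coordinates, so that the ring operations can be treated
  directly; irrationality of \<theta> makes it a function.\<close>

definition conj_pair :: "real \<Rightarrow> real \<Rightarrow> bool" where
  "conj_pair x y \<longleftrightarrow> (\<exists>p q::int. x = of_int p + of_int q * \<theta> \<and> y = of_int p + of_int q * \<gamma>)"

text \<open>A rational algebraic integer is an integer, but then
  \<open>1 / \<theta> = \<theta> - real a\<close> would be an integer strictly between 0 and
  1.\<close>

lemma theta_irrational: "\<theta> \<notin> \<rat>"
proof
  assume r: "\<theta> \<in> \<rat>"
  have "algebraic_int \<theta>"
    using theta_sq
    by (intro algebraic_int.intros[of "[:- 1, - real a, 1:]"])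
      (auto simp: coeff_pCons power2_eq_square algebra_simps split: nat.splits)
  hence "\<theta> \<in> \<int>" using r by (rule rational_algebraic_int_is_int)
  hence "1 / \<theta> \<in> \<int>" unfolding inverse_theta by simp
  moreover have "0 < 1 / \<theta>" "1 / \<theta> < 1" using theta_gt_1 by auto
  ultimately show False by (metis Ints_cases less_irrefl of_int_0_less_iff of_int_less_1_iff zless_imp_add1_zle add_0 not_less)
qed

lemma conj_pair_unique: "conj_pair x y \<Longrightarrow> conj_pair x z \<Longrightarrow> y = z"
proof -
  assume "conj_pair x y" "conj_pair x z"
  then obtain p q r s :: int where e: "x = of_int p + of_int q * \<theta>" "y = of_int p + of_int q * \<gamma>"
      "x = of_int r + of_int s * \<theta>" "z = of_int r + of_int s * \<gamma>"
    unfolding conj_pair_def by blast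
  have "q = s"
  proof (rule ccontr)
    assume "q \<noteq> s"
    hence "\<theta> = of_int (r - p) / of_int (q - s)"
      using e by (simp add: field_simps)
    thus False using theta_irrational by (metis Rats_divide Rats_of_int)
  qed
  thus "y = z" using e by simp
qed

lemma conj_pair_theta: "conj_pair \<theta> \<gamma>"
  unfolding conj_pair_def by (intro exI[of _ 0] exI[of _ 1]) simp

lemma conj_pair_inverse_theta: "conj_pair (inverse \<theta>) (inverse \<gamma>)"
proof -
  have "inverse \<theta> = \<theta> - real a" using inverse_theta by (simp add: divide_inverse)
  moreover have "inverse \<gamma> = - \<theta>" using theta_nz by (simp add: \<gamma>_def)
  ultimately show ?thesis
    unfolding conj_pair_def gamma_eq by (intro exI[of _ "- int a"] exI[of _ 1]) simp
qed

lemma conj_pair_of_int: "conj_pair (of_int n) (of_int n)"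
  unfolding conj_pair_def by (intro exI[of _ n] exI[of _ 0]) simp

lemma conj_pair_add: "conj_pair x y \<Longrightarrow> conj_pair z w \<Longrightarrow> conj_pair (x + z) (y + w)"
proof -
  assume "conj_pair x y" "conj_pair z w"
  then obtain p q r s :: int where "x = of_int p + of_int q * \<theta>" "y = of_int p + of_int q * \<gamma>"
      "z = of_int r + of_int s * \<theta>" "w = of_int r + of_int s * \<gamma>"
    by (auto simp: conj_pair_def)
  thus ?thesis unfolding conj_pair_def
    by (intro exI[of _ "p + r"] exI[of _ "q + s"]) (simp add: algebra_simps)
qed

lemma conj_pair_mult: "conj_pair x y \<Longrightarrow> conj_pair z w \<Longrightarrow> conj_pair (x * z) (y * w)"
proof -
  assume "conj_pair x y" "conj_pair z w"
  then obtain p q r s :: int where e: "x = of_int p + of_int q * \<theta>" "y = of_int p + of_int q * \<gamma>"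
      "z = of_int r + of_int s * \<theta>" "w = of_int r + of_int s * \<gamma>"
    by (auto simp: conj_pair_def)
  \<comment> \<open>Reducing \<open>t\<^sup>2\<close> by the quadratic equation gives the same
    coordinates for both roots.\<close>
  have *: "(of_int p + of_int q * t) * (of_int r + of_int s * t)
      = of_int (p * r + q * s) + of_int (p * s + q * r + q * s * int a) * t"
    if "t\<^sup>2 = real a * t + 1" for t :: real
  proof -
    have "(of_int p + of_int q * t) * (of_int r + of_int s * t)
        = of_int (p * r) + of_int (p * s + q * r) * t + of_int (q * s) * t\<^sup>2"
      by (simp add: algebra_simps power2_eq_square)
    thus ?thesis unfolding that by (simp add: algebra_simps)
  qed
  show ?thesis unfolding conj_pair_def e
    using *[OF theta_sq] *[OF gamma_sq] by blast
qed

lemma conj_pair_uminus: "conj_pair x y \<Longrightarrow> conj_pair (- x) (- y)"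
  using conj_pair_mult[OF conj_pair_of_int[of "- 1"]] by simp

lemma conj_pair_diff: "conj_pair x y \<Longrightarrow> conj_pair z w \<Longrightarrow> conj_pair (x - z) (y - w)"
  using conj_pair_add[OF _ conj_pair_uminus] by simp

lemma conj_pair_power: "conj_pair x y \<Longrightarrow> conj_pair (x ^ n) (y ^ n)"
  using conj_pair_of_int[of 1] by (induction n) (auto intro: conj_pair_mult)

lemma conj_pair_powi: "conj_pair (\<theta> powi k) (\<gamma> powi k)"
  unfolding power_int_def using conj_pair_power conj_pair_theta conj_pair_inverse_theta by simp

lemma conj_pair_sum:
  "(\<And>i. i \<in> A \<Longrightarrow> conj_pair (f i) (g i)) \<Longrightarrow> conj_pair (sum f A) (sum g A)"
  using conj_pair_of_int[of 0] by (induction A rule: infinite_finite_induct) (auto intro: conj_pair_add)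

lemma conj_pair_digit_value: "conj_pair (digit_value \<theta> b) (digit_value \<gamma> b)"
  unfolding digit_value_def
  using conj_pair_of_int[of "int _"] by (intro conj_pair_sum conj_pair_mult conj_pair_powi) simp

lemma Z_adjoin_iff: "x \<in> Z_adjoin \<theta> \<longleftrightarrow> (\<exists>y. conj_pair x y)"
proof -
  interpret R: ring real_ring by (rule ring_from_type_algebra)
  have minus: "\<ominus>\<^bsub>real_ring\<^esub> y = - y" for y
    by (rule R.minus_equality) (auto simp: ring_of_type_algebra_def)
  have add: "y + z \<in> Z_adjoin \<theta>" and mult: "y * z \<in> Z_adjoin \<theta>"
    if "y \<in> Z_adjoin \<theta>" "z \<in> Z_adjoin \<theta>" for y z
    using generate_ring.eng_add[of y real_ring "{\<theta>}" z] generate_ring.eng_mult[of y real_ring "{\<theta>}" z] that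
    by (simp_all add: Z_adjoin_def ring_of_type_algebra_def)
  have one: "1 \<in> Z_adjoin \<theta>" and theta: "\<theta> \<in> Z_adjoin \<theta>"
    using generate_ring.one[of real_ring "{\<theta>}"] generate_ring.incl[of \<theta> "{\<theta>}" real_ring]
    by (simp_all add: Z_adjoin_def ring_of_type_algebra_def)
  have neg: "- y \<in> Z_adjoin \<theta>" if "y \<in> Z_adjoin \<theta>" for y
    using generate_ring.a_inv[of y real_ring "{\<theta>}"] that by (simp add: Z_adjoin_def minus)
  have zero: "0 \<in> Z_adjoin \<theta>" using add[OF one neg[OF one]] by simp
  have nat: "of_nat n \<in> Z_adjoin \<theta>" for n
    by (induction n) (use zero one add in auto)
  have int: "of_int n \<in> Z_adjoin \<theta>" for n
    using nat neg[OF nat] by (cases n rule: int_cases2) auto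
  show ?thesis
  proof
    assume "x \<in> Z_adjoin \<theta>"
    thus "\<exists>y. conj_pair x y"
      unfolding Z_adjoin_def
    proof (induction rule: generate_ring.induct)
      case one
      thus ?case using conj_pair_of_int[of 1] by (auto simp: ring_of_type_algebra_def)
    next
      case (incl h)
      thus ?case using conj_pair_theta by auto
    next
      case (a_inv h)
      thus ?case using conj_pair_uminus unfolding minus by blast
    next
      case (eng_add h1 h2)
      then obtain y1 y2 where "conj_pair h1 y1" "conj_pair h2 y2" by blast
      from conj_pair_add[OF this] show ?case by (auto simp: ring_of_type_algebra_def)
    next
      case (eng_mult h1 h2)
      then obtain y1 y2 where "conj_pair h1 y1" "conj_pair h2 y2" by blast
      from conj_pair_mult[OF this] show ?case by (auto simp: ring_of_type_algebra_def)
    qed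
  next
    assume "\<exists>y. conj_pair x y"
    thus "x \<in> Z_adjoin \<theta>" using add mult int theta by (auto simp: conj_pair_def)
  qed
qed

definition conjug :: "real \<Rightarrow> real" where
  "conjug x = (THE y. conj_pair x y)"

lemma conjug_eq: "conj_pair x y \<Longrightarrow> conjug x = y"
  unfolding conjug_def using conj_pair_unique by blast

lemma conjug_pair: "x \<in> Z_adjoin \<theta> \<Longrightarrow> conj_pair x (conjug x)"
  using conjug_eq by (auto simp: Z_adjoin_iff)

lemma Z_adjoin_add: "x \<in> Z_adjoin \<theta> \<Longrightarrow> y \<in> Z_adjoin \<theta> \<Longrightarrow> x + y \<in> Z_adjoin \<theta>"
  and Z_adjoin_diff: "x \<in> Z_adjoin \<theta> \<Longrightarrow> y \<in> Z_adjoin \<theta> \<Longrightarrow> x - y \<in> Z_adjoin \<theta>"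
  and Z_adjoin_uminus: "x \<in> Z_adjoin \<theta> \<Longrightarrow> - x \<in> Z_adjoin \<theta>"
  and Z_adjoin_powi: "\<theta> powi k \<in> Z_adjoin \<theta>"
  and Z_adjoin_digit_value: "digit_value \<theta> b \<in> Z_adjoin \<theta>"
  unfolding Z_adjoin_iff
  using conj_pair_add conj_pair_diff conj_pair_uminus conj_pair_powi conj_pair_digit_value by blast+

lemma conjug_add: "x \<in> Z_adjoin \<theta> \<Longrightarrow> y \<in> Z_adjoin \<theta> \<Longrightarrow> conjug (x + y) = conjug x + conjug y"
  and conjug_diff: "x \<in> Z_adjoin \<theta> \<Longrightarrow> y \<in> Z_adjoin \<theta> \<Longrightarrow> conjug (x - y) = conjug x - conjug y"
  and conjug_uminus: "x \<in> Z_adjoin \<theta> \<Longrightarrow> conjug (- x) = - conjug x"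
  and conjug_powi: "conjug (\<theta> powi k) = \<gamma> powi k"
  and conjug_digit_value: "conjug (digit_value \<theta> b) = digit_value \<gamma> b"
  by (intro conjug_eq conj_pair_add conj_pair_diff conj_pair_uminus conj_pair_powi conj_pair_digit_value
      conjug_pair; assumption)+

text \<open>The cones spanned by consecutive powers \<open>\<theta> powi (- n)\<close> and \<open>\<theta> powi (- n - 1)\<close> exhaust the
  half-plane of elements of positive value as \<open>n\<close> grows.\<close>
lemma positive_imp_expand:
  assumes "x \<in> Z_adjoin \<theta>" "x > 0"
  shows "\<exists>M. expand M = x"
proof -
  obtain p q :: int where pq: "x = of_int p + of_int q * \<theta>"
    using assms by (auto simp: Z_adjoin_iff conj_pair_def)
  define y where "y = of_int p + of_int q * \<gamma>"
  \<comment> \<open>Coordinates of \<open>\<theta> ^ n * x\<close> in the basis \<theta>, 1.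
    Multiplication by \<theta> sends \<open>u\<close>, \<open>v\<close> to \<open>a * u + v\<close>,
    \<open>u\<close>.\<close>
  have ex: "\<exists>u v :: int. of_int u * \<theta> + of_int v = \<theta> ^ n * x \<and> of_int u * \<gamma> + of_int v = \<gamma> ^ n * y" for n
  proof (induction n)
    case 0
    show ?case using pq y_def by (intro exI[of _ q] exI[of _ p]) auto
  next
    case (Suc n)
    then obtain u v :: int where uv: "of_int u * \<theta> + of_int v = \<theta> ^ n * x" "of_int u * \<gamma> + of_int v = \<gamma> ^ n * y"
      by blast
    have *: "of_int (int a * u + v) * t + of_int u = t * (of_int u * t + of_int v)"
      if "t\<^sup>2 = real a * t + 1" for t :: real
    proof -
      have "t * (of_int u * t + of_int v) = of_int u * t\<^sup>2 + of_int v * t"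
        by (simp add: algebra_simps power2_eq_square)
      thus ?thesis unfolding that by (simp add: algebra_simps)
    qed
    show ?case
      using *[OF theta_sq] *[OF gamma_sq] uv
      by (intro exI[of _ "int a * u + v"] exI[of _ u]) simp
  qed
  \<comment> \<open>For such \<open>n\<close> the conjugate \<open>\<gamma> ^ n * y\<close> is so
    small against \<open>\<theta> ^ n * x\<close> that both coordinates become positive.\<close>
  obtain n where n: "\<theta>\<^sup>2 * \<bar>y\<bar> / x < \<theta> ^ n" using real_arch_pow[OF theta_gt_1] by blast
  obtain u v :: int where uv: "of_int u * \<theta> + of_int v = \<theta> ^ n * x" "of_int u * \<gamma> + of_int v = \<gamma> ^ n * y"
    using ex by blast
  have "\<bar>\<gamma> ^ n * y\<bar> \<le> 1 * \<bar>y\<bar>"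
    unfolding abs_mult power_abs using abs_gamma_less_1 by (intro mult_right_mono power_le_one) auto
  hence "\<theta>\<^sup>2 * \<bar>\<gamma> ^ n * y\<bar> \<le> \<theta>\<^sup>2 * \<bar>y\<bar>"
    by (intro mult_left_mono) auto
  also have "\<dots> < \<theta> ^ n * x" using n assms(2) by (simp add: field_simps)
  finally have big: "\<theta>\<^sup>2 * \<bar>\<gamma> ^ n * y\<bar> < \<theta> ^ n * x" .
  have "1 * \<bar>\<gamma> ^ n * y\<bar> \<le> \<theta>\<^sup>2 * \<bar>\<gamma> ^ n * y\<bar>"
    using theta_gt_1 by (intro mult_right_mono) (auto simp: one_le_power)
  hence big1: "\<bar>\<gamma> ^ n * y\<bar> < \<theta> ^ n * x" using big by simp
  have "(\<theta> - \<gamma>) * of_int u = \<theta> ^ n * x - \<gamma> ^ n * y"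
    using uv by (simp add: algebra_simps)
  also have "\<dots> > 0" using big1 by linarith
  finally have u: "u > 0" using theta_pos gamma_neg by (simp add: zero_less_mult_iff)
  \<comment> \<open>Elimination of \<open>u\<close>; the additional factor \<theta> allows \<gamma>
    to be removed by \<open>gamma_theta\<close>.\<close>
  have "\<theta> * ((\<theta> - \<gamma>) * of_int v) = \<theta>\<^sup>2 * (of_int u * \<gamma> + of_int v) - (\<gamma> * \<theta>) * (of_int u * \<theta> + of_int v)"
    by (simp add: algebra_simps power2_eq_square)
  also have "\<dots> = \<theta>\<^sup>2 * (\<gamma> ^ n * y) + \<theta> ^ n * x"
    unfolding uv gamma_theta by simp
  also have "\<dots> > 0"
  proof -
    have "- (\<theta>\<^sup>2 * (\<gamma> ^ n * y)) \<le> \<theta>\<^sup>2 * \<bar>\<gamma> ^ n * y\<bar>"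
      by (metis abs_ge_minus_self abs_mult abs_power2)
    thus ?thesis using big by linarith
  qed
  finally have v: "v > 0" using theta_pos gamma_neg by (simp add: zero_less_mult_iff)
  define M where "M = replicate_mset (nat u) (1 - int n) + replicate_mset (nat v) (- int n)"
  have "expand M = \<theta> powi (- int n) * (of_int u * \<theta> + of_int v)"
    using u v theta_nz by (simp add: M_def power_int_diff power_int_minus field_simps)
  also have "\<dots> = x" unfolding uv using theta_nz by (simp add: power_int_minus)
  finally show ?thesis by blast
qed

lemma positive_greedy:
  assumes "x \<in> Z_adjoin \<theta>" "x > 0"
  obtains b where "greedy_poly a b" "digit_value \<theta> b = x"
proof -
  obtain M where M: "expand M = x" using positive_imp_expand[OF assms] by blast
  obtain N where "expand N = expand M" "greedy_poly a (count N)"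
    using greedy_normal_form by blast
  thus ?thesis using that[of "count N"] M by (simp add: digit_value_count expand_def)
qed

section \<open>Comparison of the absolute value with the conjugate\<close>

lemma digit_value_nonneg: "digit_value \<theta> b \<ge> 0"
  unfolding digit_value_def using theta_pos by (intro sum_nonneg) auto

lemma digit_value_ge:
  assumes "finite {i. b i \<noteq> 0}" "b k \<noteq> 0"
  shows "\<theta> powi k \<le> digit_value \<theta> b"
proof -
  have "1 * \<theta> powi k \<le> real (b k) * \<theta> powi k"
    using assms theta_pos by (intro mult_right_mono) auto
  also have "\<dots> \<le> digit_value \<theta> b"
    unfolding digit_value_def using assms theta_pos by (intro member_le_sum) auto
  finally show ?thesis by simp
qed

text \<open>The greedy expansion of \<open>\<bar>x\<bar>\<close> is unique, so its lowest exponent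
  is the greedy order. The bounds for the conjugate of a string starting there give both
  inequalities.\<close>

lemma theta_abs_bounds:
  assumes "x \<in> Z_adjoin \<theta>"
  shows "theta_abs \<theta> a x \<le> \<theta> * \<bar>conjug x\<bar>" "\<bar>conjug x\<bar> \<le> \<theta> * theta_abs \<theta> a x"
proof -
  have "theta_abs \<theta> a x \<le> \<theta> * \<bar>conjug x\<bar> \<and> \<bar>conjug x\<bar> \<le> \<theta> * theta_abs \<theta> a x"
  proof (cases "x = 0")
    case True
    thus ?thesis using conjug_eq[OF conj_pair_of_int[of 0]] by (simp add: theta_abs_def)
  next
    case False
    have ax: "\<bar>x\<bar> \<in> Z_adjoin \<theta>" "\<bar>x\<bar> > 0"
      using assms Z_adjoin_uminus False by (auto simp: abs_if)
    obtain b where b: "greedy_poly a b" "digit_value \<theta> b = \<bar>x\<bar>" using positive_greedy[OF ax] by blast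
    have fin: "finite {i. b i \<noteq> 0}" by (rule greedy_polyD[OF b(1)])
    have ne: "{i. b i \<noteq> 0} \<noteq> {}"
    proof
      assume "{i. b i \<noteq> 0} = {}"
      hence "digit_value \<theta> b = 0" by (simp only: digit_value_def sum.empty)
      thus False using ax b by simp
    qed
    define m where "m = Min {i. b i \<noteq> 0}"
    have m: "b m \<noteq> 0" using Min_in[OF fin ne] by (simp add: m_def)
    have lo: "b i = 0" if "i < m" for i
      using Min_le[OF fin, of i] that by (force simp: m_def)
    have "greedy_order \<theta> a x = m"
      unfolding greedy_order_def
    proof (rule the_equality)
      show "\<exists>b. greedy_poly a b \<and> b m \<noteq> 0 \<and> (\<forall>i<m. b i = 0) \<and>
             (x = digit_value \<theta> b \<or> x = - digit_value \<theta> b)"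
        using b m lo by (intro exI[of _ b]) (auto simp: abs_if split: if_splits)
    next
      fix l
      assume "\<exists>b. greedy_poly a b \<and> b l \<noteq> 0 \<and> (\<forall>i<l. b i = 0) \<and>
             (x = digit_value \<theta> b \<or> x = - digit_value \<theta> b)"
      then obtain c where c: "greedy_poly a c" "c l \<noteq> 0" "\<And>i. i < l \<Longrightarrow> c i = 0"
        "x = digit_value \<theta> c \<or> x = - digit_value \<theta> c" by blast
      \<comment> \<open>Digit values are nonnegative, so both strings represent
        \<open>\<bar>x\<bar>\<close>, whichever sign occurs.\<close>
      have "digit_value \<theta> c = digit_value \<theta> b"
        using c(4) b(2) digit_value_nonneg[of c] by auto
      hence "digit_value \<gamma> c = digit_value \<gamma> b" by (metis conjug_digit_value)
      hence "c = b" using greedy_poly_unique c(1) b(1) by blast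
      thus "l = m" using c(2,3) m lo by (metis linorder_neqE)
    qed
    hence th: "theta_abs \<theta> a x = \<theta> powi (- m)" using False by (simp add: theta_abs_def)
    have "\<bar>conjug x\<bar> = \<bar>conjug \<bar>x\<bar>\<bar>" using conjug_uminus[OF assms] by (auto simp: abs_if)
    also have "\<dots> = \<bar>digit_value \<gamma> b\<bar>" unfolding b(2)[symmetric] conjug_digit_value ..
    finally have "\<bar>conjug x\<bar> = \<bar>digit_value \<gamma> b\<bar>" .
    thus ?thesis
      using abs_digit_value_le[OF b(1) lo] abs_digit_value_ge[OF b(1) lo m] theta_pos th
      by (simp add: field_simps)
  qed
  thus "theta_abs \<theta> a x \<le> \<theta> * \<bar>conjug x\<bar>" "\<bar>conjug x\<bar> \<le> \<theta> * theta_abs \<theta> a x" by auto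
qed

lemma theta_abs_nonneg: "theta_abs \<theta> a x \<ge> 0"
  using theta_pos by (simp add: theta_abs_def)

end

subsection \<open>The completion\<close>

locale monogenic_unit = unit_base +
  assumes integers_eq: "ring_of_integers \<theta> = Z_adjoin \<theta>"
begin

lemma theta_Cauchy_iff:
  assumes "\<And>n. f n \<in> Z_adjoin \<theta>"
  shows "theta_Cauchy \<theta> a f \<longleftrightarrow> Cauchy (\<lambda>n. conjug (f n))"
proof
  have bd: "theta_abs \<theta> a (f m - f n) \<le> \<theta> * \<bar>conjug (f m) - conjug (f n)\<bar>"
    "\<bar>conjug (f m) - conjug (f n)\<bar> \<le> \<theta> * theta_abs \<theta> a (f m - f n)" for m n
    using theta_abs_bounds[OF Z_adjoin_diff[OF assms[of m] assms[of n]]]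
      conjug_diff[OF assms[of m] assms[of n]] by simp_all
  show "Cauchy (\<lambda>n. conjug (f n))" if c: "theta_Cauchy \<theta> a f"
  proof (rule CauchyI)
    fix e :: real assume "e > 0"
    hence "e / \<theta> > 0" using theta_pos by simp
    then obtain N where N: "\<And>m n. m \<ge> N \<Longrightarrow> n \<ge> N \<Longrightarrow> theta_abs \<theta> a (f m - f n) < e / \<theta>"
      using c unfolding theta_Cauchy_def by meson
    have "\<bar>conjug (f m) - conjug (f n)\<bar> < e" if "m \<ge> N" "n \<ge> N" for m n
      using bd(2)[of m n] N[OF that] theta_pos by (simp add: field_simps)
    thus "\<exists>M. \<forall>m\<ge>M. \<forall>n\<ge>M. norm (conjug (f m) - conjug (f n)) < e" by auto
  qed
  show "theta_Cauchy \<theta> a f" if c: "Cauchy (\<lambda>n. conjug (f n))"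
    unfolding theta_Cauchy_def
  proof (intro allI impI)
    fix e :: real assume "e > 0"
    hence "e / \<theta> > 0" using theta_pos by simp
    then obtain N where N: "\<And>m n. m \<ge> N \<Longrightarrow> n \<ge> N \<Longrightarrow> norm (conjug (f m) - conjug (f n)) < e / \<theta>"
      using CauchyD[OF c] by meson
    have "theta_abs \<theta> a (f m - f n) < e" if "m \<ge> N" "n \<ge> N" for m n
      using bd(1)[of m n] N[OF that] theta_pos by (simp add: field_simps)
    thus "\<exists>N. \<forall>m\<ge>N. \<forall>n\<ge>N. theta_abs \<theta> a (f m - f n) < e" by blast
  qed
qed

lemma theta_abs_tendsto_0_iff:
  assumes "\<And>n. f n \<in> Z_adjoin \<theta>"
  shows "(\<lambda>n. theta_abs \<theta> a (f n)) \<longlonglongrightarrow> 0 \<longleftrightarrow> (\<lambda>n. conjug (f n)) \<longlonglongrightarrow> 0"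
proof
  assume "(\<lambda>n. theta_abs \<theta> a (f n)) \<longlonglongrightarrow> 0"
  thus "(\<lambda>n. conjug (f n)) \<longlonglongrightarrow> 0"
    by (rule tendsto_0_le[of _ _ _ \<theta>])
      (use theta_abs_bounds(2)[OF assms] theta_abs_nonneg in \<open>simp add: mult.commute\<close>)
next
  assume "(\<lambda>n. conjug (f n)) \<longlonglongrightarrow> 0"
  thus "(\<lambda>n. theta_abs \<theta> a (f n)) \<longlonglongrightarrow> 0"
    by (rule tendsto_0_le[of _ _ _ \<theta>])
      (use theta_abs_bounds(1)[OF assms] theta_abs_nonneg in \<open>simp add: mult.commute\<close>)
qed

text \<open>The concrete model of the completion: a coset of the null ideal is labelled by the
  common real limit of the conjugates.\<close>

definition class_at :: "real \<Rightarrow> (nat \<Rightarrow> real) set" where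
  "class_at r = {f. (\<forall>n. f n \<in> Z_adjoin \<theta>) \<and> (\<lambda>n. conjug (f n)) \<longlonglongrightarrow> r}"

lemma carrier_Cauchy_ring:
  "carrier (Cauchy_ring \<theta> a) = {f. (\<forall>n. f n \<in> Z_adjoin \<theta>) \<and> Cauchy (\<lambda>n. conjug (f n))}"
  using theta_Cauchy_iff by (auto simp: Cauchy_ring_def integers_eq)

lemma null_ideal_eq: "null_ideal \<theta> a = class_at 0"
  unfolding null_ideal_def carrier_Cauchy_ring class_at_def
  using theta_abs_tendsto_0_iff by (auto intro: LIMSEQ_imp_Cauchy)

lemma class_at_subset_carrier: "class_at r \<subseteq> carrier (Cauchy_ring \<theta> a)"
  unfolding carrier_Cauchy_ring class_at_def by (auto intro: LIMSEQ_imp_Cauchy)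

lemma null_ideal_coset:
  assumes "f \<in> class_at r"
  shows "null_ideal \<theta> a +>\<^bsub>Cauchy_ring \<theta> a\<^esub> f = class_at r"
proof -
  have "null_ideal \<theta> a +>\<^bsub>Cauchy_ring \<theta> a\<^esub> f = (\<lambda>h n. h n + f n) ` class_at 0"
    by (auto simp: a_r_coset_def' null_ideal_eq Cauchy_ring_def)
  also have "\<dots> = class_at r"
  proof (intro equalityI subsetI)
    fix g assume "g \<in> (\<lambda>h n. h n + f n) ` class_at 0"
    then obtain h where h: "h \<in> class_at 0" "g = (\<lambda>n. h n + f n)" by blast
    have "(\<lambda>n. conjug (h n) + conjug (f n)) \<longlonglongrightarrow> 0 + r"
      using h assms by (intro tendsto_add) (auto simp: class_at_def)
    thus "g \<in> class_at r"
      using h assms Z_adjoin_add conjug_add by (simp add: class_at_def)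
  next
    fix g assume g: "g \<in> class_at r"
    have "(\<lambda>n. conjug (g n) - conjug (f n)) \<longlonglongrightarrow> r - r"
      using g assms by (intro tendsto_diff) (auto simp: class_at_def)
    hence "(\<lambda>n. g n - f n) \<in> class_at 0"
      using g assms Z_adjoin_diff conjug_diff by (simp add: class_at_def)
    thus "g \<in> (\<lambda>h n. h n + f n) ` class_at 0"
      by (rule rev_image_eqI) simp
  qed
  finally show ?thesis .
qed

lemma class_at_eqI: "f \<in> class_at r \<Longrightarrow> f \<in> class_at s \<Longrightarrow> r = s"
  unfolding class_at_def using LIMSEQ_unique by blast

text \<open>Completeness of the reals supplies the label \<open>r\<close>; nonemptiness provides a
  representative whose coset is \<open>class_at r\<close>.\<close>

lemma carrier_completion:
  "C \<in> carrier (theta_completion \<theta> a) \<longleftrightarrow> (\<exists>r. C = class_at r \<and> class_at r \<noteq> {})"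
proof
  assume "C \<in> carrier (theta_completion \<theta> a)"
  then obtain f where f: "f \<in> carrier (Cauchy_ring \<theta> a)" "C = null_ideal \<theta> a +>\<^bsub>Cauchy_ring \<theta> a\<^esub> f"
    by (auto simp: theta_completion_def FactRing_def A_RCOSETS_def')
  then obtain r where "f \<in> class_at r"
    by (auto simp: carrier_Cauchy_ring class_at_def Cauchy_convergent_iff convergent_def)
  thus "\<exists>r. C = class_at r \<and> class_at r \<noteq> {}" using f null_ideal_coset by blast
next
  assume "\<exists>r. C = class_at r \<and> class_at r \<noteq> {}"
  then obtain r f where C: "C = class_at r" and f: "f \<in> class_at r" by blast
  have "f \<in> carrier (Cauchy_ring \<theta> a)" using f class_at_subset_carrier by blast
  thus "C \<in> carrier (theta_completion \<theta> a)"
    unfolding theta_completion_def FactRing_def A_RCOSETS_def' C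
    using null_ideal_coset[OF f] by auto
qed

lemma Cauchy_class_eq:
  assumes "\<alpha> \<in> Z_adjoin \<theta>" shows "Cauchy_class \<theta> a \<alpha> = class_at (conjug \<alpha>)"
  unfolding Cauchy_class_def by (rule null_ideal_coset) (simp add: class_at_def assms)

lemma partial_sum_seq_in_class:
  assumes "x \<in> greedy_Laurent a" "partial_sum_seq \<theta> a x s"
  shows "s \<in> class_at (lval x)"
proof -
  obtain M where M: "filterlim M at_top sequentially"
    "\<And>n. \<exists>d. greedy_poly a d \<and> (\<forall>j\<le>M n. d j = 0) \<and>
                s n = digit_value \<theta> (digit_trunc x (M n)) + digit_value \<theta> d"
    using assms(2) by (auto simp: partial_sum_seq_def)
  from M(2) obtain d where d: "\<And>n. greedy_poly a (d n)" "\<And>n j. j \<le> M n \<Longrightarrow> d n j = 0"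
    "\<And>n. s n = digit_value \<theta> (digit_trunc x (M n)) + digit_value \<theta> (d n)"
    by metis
  have s: "conjug (s n) = digit_value \<gamma> (digit_trunc x (M n)) + digit_value \<gamma> (d n)" for n
    unfolding d(3) by (simp add: conjug_add Z_adjoin_digit_value conjug_digit_value)
  \<comment> \<open>The error string starts at \<open>M n + 1\<close> at the earliest, which absorbs
    the factor \<theta> of the general bound.\<close>
  have small: "\<bar>digit_value \<gamma> (d n)\<bar> \<le> \<theta> powi (- M n)" for n
    using abs_digit_value_le[OF d(1)[of n], of "M n + 1"] d(2)[of _ n] theta_nz
    by (simp add: power_int_diff)
  have "(\<lambda>n. digit_value \<gamma> (d n)) \<longlonglongrightarrow> 0"
  proof (rule tendstoI)
    fix e :: real assume e: "e > 0"
    obtain K :: int where K: "1 / e < \<theta> powi K" using unbounded_powi by blast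
    have "\<forall>\<^sub>F n in sequentially. K \<le> M n"
      using M(1) by (simp add: filterlim_at_top)
    thus "\<forall>\<^sub>F n in sequentially. dist (digit_value \<gamma> (d n)) 0 < e"
    proof eventually_elim
      case (elim n)
      have "\<bar>digit_value \<gamma> (d n)\<bar> \<le> \<theta> powi (- K)"
        using small[of n] powi_mono[of "- M n" "- K"] elim by simp
      also have "\<dots> < e"
        using K e theta_pos by (simp add: power_int_minus field_simps)
      finally show ?case by simp
    qed
  qed
  moreover obtain m where "digits_le x" "\<And>i. i < m \<Longrightarrow> x i = 0"
    using assms(1) by (auto simp: greedy_Laurent_iff admissible_def)
  hence "(\<lambda>n. digit_value \<gamma> (digit_trunc x (M n))) \<longlonglongrightarrow> lval x"
    using trunc_tendsto M(1) lval_eq by metis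
  ultimately have "(\<lambda>n. conjug (s n)) \<longlonglongrightarrow> lval x"
    unfolding s using tendsto_add by fastforce
  moreover have "s n \<in> Z_adjoin \<theta>" for n
    unfolding d(3) by (intro Z_adjoin_add Z_adjoin_digit_value)
  ultimately show ?thesis by (simp add: class_at_def)
qed

lemma partial_sum_seq_trunc: "partial_sum_seq \<theta> a x (\<lambda>n. digit_value \<theta> (digit_trunc x (int n)))"
  unfolding partial_sum_seq_def
proof (intro exI conjI allI)
  show "mono int" by (simp add: mono_def)
  show "filterlim int at_top sequentially" by (rule filterlim_int_sequentially)
  show "greedy_poly a (\<lambda>_. 0)" using a_ge_1 by (simp add: greedy_poly_def)
qed (simp_all add: digit_value_def)

text \<open>The truncations are themselves a sequence of partial sums, and classes with different
  labels are disjoint, so only one class can contain all such sequences.\<close>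

lemma Cauchy_class_series_eq:
  assumes "x \<in> greedy_Laurent a"
  shows "Cauchy_class_series \<theta> a x = class_at (lval x)"
  unfolding Cauchy_class_series_def
proof (rule the_equality)
  have t: "(\<lambda>n. digit_value \<theta> (digit_trunc x (int n))) \<in> class_at (lval x)"
    by (rule partial_sum_seq_in_class[OF assms partial_sum_seq_trunc])
  show "class_at (lval x) \<in> carrier (theta_completion \<theta> a) \<and>
      (\<forall>s. partial_sum_seq \<theta> a x s \<longrightarrow> s \<in> class_at (lval x))"
    using t partial_sum_seq_in_class[OF assms] unfolding carrier_completion by blast
  fix C
  assume C: "C \<in> carrier (theta_completion \<theta> a) \<and> (\<forall>s. partial_sum_seq \<theta> a x s \<longrightarrow> s \<in> C)"
  then obtain r where r: "C = class_at r" unfolding carrier_completion by blast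
  have "(\<lambda>n. digit_value \<theta> (digit_trunc x (int n))) \<in> class_at r"
    using C partial_sum_seq_trunc r by blast
  thus "C = class_at (lval x)" using r t class_at_eqI by blast
qed

lemma Cauchy_class_series_eq_iff:
  assumes "\<alpha> \<in> Z_adjoin \<theta>" "x \<in> greedy_Laurent a"
  shows "Cauchy_class_series \<theta> a x = Cauchy_class \<theta> a \<alpha> \<longleftrightarrow> lval x = conjug \<alpha>"
proof -
  have "(\<lambda>n. \<alpha>) \<in> class_at (conjug \<alpha>)" by (simp add: class_at_def assms)
  thus ?thesis
    unfolding Cauchy_class_eq[OF assms(1)] Cauchy_class_series_eq[OF assms(2)]
    using class_at_eqI by metis
qed

section \<open>The two expansions of a negative element\<close>

text \<open>As \<open>\<alpha> + \<theta> powi k\<close> lies strictly between 0 and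
  \<open>\<theta> powi k\<close>, its greedy polynomial stops below \<open>k\<close>. Appending
  \<open>alt k\<close> there changes the value by \<open>- (\<gamma> powi k)\<close>, the conjugate
  of \<open>- (\<theta> powi k)\<close>.\<close>

lemma negative_expansion:
  assumes "\<alpha> \<in> Z_adjoin \<theta>" "\<alpha> < 0" "- \<alpha> < \<theta> powi k"
  shows "\<exists>x\<in>greedy_Laurent a. lval x = conjug \<alpha> \<and> tail_alt x k"
proof -
  have p: "\<alpha> + \<theta> powi k \<in> Z_adjoin \<theta>" "\<alpha> + \<theta> powi k > 0"
    using assms Z_adjoin_add Z_adjoin_powi by auto
  obtain b where b: "greedy_poly a b" "digit_value \<theta> b = \<alpha> + \<theta> powi k"
    using positive_greedy[OF p] by blast
  note fin = greedy_polyD(3)[OF b(1)] and dig = greedy_polyD(2)[OF b(1)]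
  have hi: "b i = 0" if "i \<ge> k" for i
  proof (rule ccontr)
    assume "b i \<noteq> 0"
    hence "\<theta> powi i \<le> \<alpha> + \<theta> powi k" using digit_value_ge[OF fin] b by simp
    thus False using powi_mono[OF that] assms by simp
  qed
  obtain m0 where m0: "\<And>i. i < m0 \<Longrightarrow> b i = 0" using finite_support_bounds[OF fin] by metis
  \<comment> \<open>A common starting place of \<open>b\<close> and \<open>x\<close> that is also at
    most \<open>k\<close>, as \<open>V_diff_agree\<close> requires.\<close>
  define m where "m = min m0 k"
  define x where "x i = (if i < k then b i else alt k i)" for i
  have lo: "x i = 0" "b i = 0" if "i < m" for i
    using m0 that by (auto simp: m_def x_def)
  have adm: "admissible x"
    unfolding admissible_def digits_le_def
  proof (intro conjI allI impI)
    show "x i \<le> a" for i using dig by (auto simp: x_def digits_le_def alt_def)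
    fix i assume i: "x i = a"
    \<comment> \<open>The junction is harmless: \<open>alt k k\<close> is 0, so place
      \<open>k\<close> demands nothing of \<open>k - 1\<close> and satisfies the demand of
      \<open>k + 1\<close>.\<close>
    consider "i < k" | "i = k" | "i > k" by linarith
    thus "x (i - 1) = 0"
    proof cases
      case 1
      thus ?thesis using i b(1) by (simp add: x_def greedy_poly_def)
    next
      case 2
      thus ?thesis using i a_ge_1 by (simp add: x_def alt_def)
    next
      case 3
      thus ?thesis using i a_ge_1 by (auto simp: x_def alt_def split: if_splits)
    qed
  qed
  hence dx: "digits_le x" by (simp add: admissible_def)
  have Vx: "V x k = - 1"
    unfolding V_alt[of k, symmetric] V_def by (simp add: x_def)
  have Vb: "V b k = 0" by (simp add: V_def hi)
  have "lval x - lval b = \<gamma> powi m * (V x m - V b m)"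
    using lval_eq[OF dx lo(1)] lval_eq[OF dig lo(2)] by (simp add: algebra_simps)
  also have "\<dots> = \<gamma> powi k * (V x k - V b k)"
    by (rule V_diff_agree[OF dx dig]) (auto simp: m_def x_def)
  also have "\<dots> = - conjug (\<theta> powi k)" by (simp add: Vx Vb conjug_powi)
  finally have "lval x = lval b - conjug (\<theta> powi k)" by simp
  also have "lval b = conjug (\<alpha> + \<theta> powi k)"
    by (simp only: lval_finite[OF fin] flip: b(2) conjug_digit_value)
  finally have "lval x = conjug \<alpha>" using conjug_add[OF assms(1) Z_adjoin_powi] by simp
  moreover have "x \<in> greedy_Laurent a" using adm lo(1) greedy_Laurent_iff by blast
  moreover have "tail_alt x k" unfolding tail_alt_def by (intro exI[of _ k]) (simp add: x_def)
  ultimately show ?thesis by blast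
qed

text \<open>Distinct series of equal value have alternating tails of opposite parity. The places
  \<open>k\<close> and \<open>k + 1\<close> realise both parities, and a third series would need a
  parity opposite to each.\<close>

lemma exactly_two_expansions:
  assumes "\<alpha> \<in> Z_adjoin \<theta>" "\<alpha> < 0"
  shows "\<exists>x y. x \<noteq> y \<and> {z \<in> greedy_Laurent a. lval z = conjug \<alpha>} = {x, y}"
proof -
  obtain k :: int where k: "- \<alpha> < \<theta> powi k" using unbounded_powi by blast
  hence k': "- \<alpha> < \<theta> powi (k + 1)" using powi_mono[of k "k + 1"] by simp
  obtain x where x: "x \<in> greedy_Laurent a" "lval x = conjug \<alpha>" "tail_alt x k"
    using negative_expansion[OF assms k] by blast
  obtain y where y: "y \<in> greedy_Laurent a" "lval y = conjug \<alpha>" "tail_alt y (k + 1)"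
    using negative_expansion[OF assms k'] by blast
  have par: "\<exists>l. tail_alt u l \<and> tail_alt v (l + 1)"
    if "u \<in> greedy_Laurent a" "v \<in> greedy_Laurent a" "lval u = lval v" "u \<noteq> v" for u v
    using that lval_eq_imp_tail_alt by (metis greedy_Laurent_iff)
  have "z = x \<or> z = y" if z: "z \<in> greedy_Laurent a" "lval z = conjug \<alpha>" for z
  proof (rule ccontr)
    assume "\<not> (z = x \<or> z = y)"
    then obtain l l' where "tail_alt z l" "tail_alt x (l + 1)" "tail_alt z l'" "tail_alt y (l' + 1)"
      using par[of z x] par[of z y] z x y by metis
    hence "even (l - l')" "even (k - (l + 1))" "even (k + 1 - (l' + 1))"
      using tail_alt_parity x(3) y(3) by blast+
    thus False by presburger
  qed
  moreover have "x \<noteq> y" using x(3) y(3) tail_alt_not_Suc by blast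
  ultimately show ?thesis using x y by blast
qed

end

theorem theorem24:
  fixes \<theta> \<alpha> :: real and a :: nat
  assumes "\<theta> > 1" and "a \<ge> 1" and "\<theta>\<^sup>2 = real a * \<theta> + 1"
    and "ring_of_integers \<theta> = Z_adjoin \<theta>"
    and "\<alpha> \<in> ring_of_integers \<theta>" and "\<alpha> < 0"
  shows "\<exists>\<alpha>\<^sub>1 \<alpha>\<^sub>2. \<alpha>\<^sub>1 \<noteq> \<alpha>\<^sub>2 \<and>
           {x \<in> greedy_Laurent a. Cauchy_class_series \<theta> a x = Cauchy_class \<theta> a \<alpha>} = {\<alpha>\<^sub>1, \<alpha>\<^sub>2} \<and>
           Cauchy_class \<theta> a \<alpha> = Cauchy_class_series \<theta> a \<alpha>\<^sub>1 \<and>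
           Cauchy_class \<theta> a \<alpha> = Cauchy_class_series \<theta> a \<alpha>\<^sub>2"
proof -
  interpret monogenic_unit \<theta> a
    using assms by unfold_locales auto
  have \<alpha>: "\<alpha> \<in> Z_adjoin \<theta>" using assms by simp
  obtain x y where xy: "x \<noteq> y" "{z \<in> greedy_Laurent a. lval z = conjug \<alpha>} = {x, y}"
    using exactly_two_expansions[OF \<alpha> assms(6)] by blast
  have "{z \<in> greedy_Laurent a. Cauchy_class_series \<theta> a z = Cauchy_class \<theta> a \<alpha>} = {x, y}"
    using xy(2) Cauchy_class_series_eq_iff[OF \<alpha>] by blast
  moreover from this have "Cauchy_class_series \<theta> a x = Cauchy_class \<theta> a \<alpha>"
    "Cauchy_class_series \<theta> a y = Cauchy_class \<theta> a \<alpha>" by blast+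
  ultimately show ?thesis using xy(1) by metis
qed

end
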